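(* Let $(\Omega,\Sigma)$ be a standard Borel space, let $\lambda\in NA^+$, let $f:[0,\lambda(\Omega)]\to\mathbb{R}$ be a function with $f(0)=0$, and let $\nu=f\circ\lambda$ be the corresponding scalar measure game. The following are equivalent: (1) $\nu\in AC_\infty$; (2) $f$ is Lipschitz on the interval $[0,\lambda(\Omega)]$ (with $\mu(\Omega)$ as Lipschitz constant, for each $\mu\in NA^+$ for which $|\nu(T)-\nu(S)|\le\mu(T)-\mu(S)$ holds for all $S\subset T$ in $\Sigma$); (3) the inequality $|\nu(T)-\nu(S)|\le\mu(T)-\mu(S)$ for all $S\subset T$ in $\Sigma$ holds for $\mu=L\lambda$, with $L$ a Lipschitz constant for $f$.
   Context: A standard Borel space $(\Omega,\Sigma)$ is a Borel set $\Omega$ of a Polish space together with the family $\Sigma$ of its Borel subsets. A game is a set function $\nu:\Sigma\to\mathbb{R}$ with $\nu(\emptyset)=0$; it is monotone if $\nu(A)\le\nu(B)$ whenever $A\subseteq B$. $NA^+$ is the set of nonnegative (finite) nonatomic countably additive measures on $\Sigma$. $BV$ is the space of games with $\sup\sum_i|\nu(S_i)-\nu(S_{i-1})|<\infty$, the supremum being over all finite chains $\emptyset=S_0\subset S_1\subset\dots\subset S_m=\Omega$ in $\Sigma$. $AC_\infty$ is the class of Lipschitz games: games $\nu\in BV$ for which there is $\mu\in NA^+$ such that both $\mu-\nu$ and $\mu+\nu$ are monotone; equivalently, $|\nu(T)-\nu(S)|\le\mu(T)-\mu(S)$ for all $S\subset T$ in $\Sigma$.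
   Formalization: In (2), the Lipschitz constant μ(Ω) is replaced by μ(Ω)/λ(Ω) for general λ, and μ(Ω) itself is asserted only when λ(Ω) ≥ 1; as written it fails, e.g. for λ = μ Lebesgue measure on [0,1/2] and f the identity. *)

theory Defs
  imports "HOL-Analysis.Analysis"
begin

text \<open>
  A measure \<open>M\<close> below only serves to carry a measurable space
  \<open>(space M, sets M)\<close>; its measure function is never used.  A game is represented by
  a total function on \<open>'a set\<close>, of which only the values on \<open>sets M\<close> matter.
\<close>

definition nonatomic :: "'a measure \<Rightarrow> bool" where
  "nonatomic \<mu> \<longleftrightarrow>
     (\<forall>A\<in>sets \<mu>. emeasure \<mu> A > 0 \<longrightarrow>
        (\<exists>B\<in>sets \<mu>. B \<subseteq> A \<and> 0 < emeasure \<mu> B \<and> emeasure \<mu> B < emeasure \<mu> A))"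

definition NA_plus :: "'a measure \<Rightarrow> 'a measure set" where
  "NA_plus M = {\<mu>. sets \<mu> = sets M \<and> finite_measure \<mu> \<and> nonatomic \<mu>}"

definition games :: "'a measure \<Rightarrow> ('a set \<Rightarrow> real) set" where
  "games M = {\<nu>. \<nu> {} = 0}"

text \<open>
  The chains in the definition of \<open>BV\<close> are taken weakly increasing: repeated members
  contribute nothing to the variation.
\<close>

definition chain_in :: "'a measure \<Rightarrow> nat \<Rightarrow> (nat \<Rightarrow> 'a set) \<Rightarrow> bool" where
  "chain_in M m S \<longleftrightarrow>
     S 0 = {} \<and> S m = space M \<and> (\<forall>i\<le>m. S i \<in> sets M) \<and> (\<forall>i<m. S i \<subseteq> S (Suc i))"

definition BV :: "'a measure \<Rightarrow> ('a set \<Rightarrow> real) set" where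
  "BV M = {\<nu> \<in> games M.
     bdd_above {(\<Sum>i=1..m. \<bar>\<nu> (S i) - \<nu> (S (i - 1))\<bar>) | m S. chain_in M m S}}"

definition AC_infty :: "'a measure \<Rightarrow> ('a set \<Rightarrow> real) set" where
  "AC_infty M = {\<nu> \<in> BV M. \<exists>\<mu>\<in>NA_plus M.
     mono_on (sets M) (\<lambda>S. measure \<mu> S - \<nu> S) \<and>
     mono_on (sets M) (\<lambda>S. measure \<mu> S + \<nu> S)}"

definition dominated_by :: "'a measure \<Rightarrow> ('a set \<Rightarrow> real) \<Rightarrow> 'a measure \<Rightarrow> bool" where
  "dominated_by M \<nu> \<mu> \<longleftrightarrow>
     (\<forall>S\<in>sets M. \<forall>T\<in>sets M. S \<subseteq> T \<longrightarrow>
        \<bar>\<nu> T - \<nu> S\<bar> \<le> measure \<mu> T - measure \<mu> S)"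

end

theory Submission
  imports Defs
begin

text \<open>
  The Lipschitz bound comes from moving small pieces of mass. By Sierpinski's theorem a
  nonatomic measure \<open>\<lambda>\<close> attains every intermediate value, so \<open>\<Omega>\<close> can be cut into \<open>q\<close> pieces of
  equal \<open>\<lambda>\<close>-measure, one of which has \<open>\<mu>\<close>-measure at most \<open>\<mu>(\<Omega>) / q\<close>. Subsets of that piece
  show that an increment of the argument of at most \<open>\<lambda>(\<Omega>) / q\<close> changes \<open>f\<close> by at most
  \<open>\<mu>(\<Omega>) / q\<close>. Subdividing an interval into such increments and letting \<open>q\<close> tend to infinity
  gives the Lipschitz constant \<open>\<mu>(\<Omega>) / \<lambda>(\<Omega>)\<close>; this avoids Lyapunov's convexity theorem.
\<close>

section \<open>Nonatomic measures and Sierpinski's theorem\<close>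

lemma nonatomic_iff_measure:
  assumes "finite_measure N"
  shows "nonatomic N \<longleftrightarrow> (\<forall>A\<in>sets N. 0 < measure N A \<longrightarrow>
    (\<exists>B\<in>sets N. B \<subseteq> A \<and> 0 < measure N B \<and> measure N B < measure N A))"
proof -
  interpret finite_measure N by fact
  show ?thesis by (simp add: nonatomic_def emeasure_eq_measure ennreal_less_iff cong: conj_cong)
qed

text \<open>A splitting of \<open>A\<close> into two pieces of positive measure has one piece of at
  most half the measure: if \<open>B\<close> is too large, its complement in \<open>A\<close>
  serves.\<close>

lemma nonatomic_halve:
  assumes "finite_measure N" "nonatomic N" "A \<in> sets N" "0 < measure N A"
  shows "\<exists>B\<in>sets N. B \<subseteq> A \<and> 0 < measure N B \<and> measure N B \<le> measure N A / 2"
proof -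
  interpret finite_measure N by fact
  obtain B where B: "B \<in> sets N" "B \<subseteq> A" "0 < measure N B" "measure N B < measure N A"
    using assms(2-4) unfolding nonatomic_iff_measure[OF assms(1)] by blast
  show ?thesis
  proof (cases "measure N B \<le> measure N A / 2")
    case True
    then show ?thesis using B by blast
  next
    case False
    moreover have "measure N (A - B) = measure N A - measure N B"
      using B assms(3) by (simp add: finite_measure_Diff)
    ultimately show ?thesis
      using B assms(3) by (intro bexI[of _ "A - B"]) auto
  qed
qed

lemma nonatomic_small_subset:
  assumes "finite_measure N" "nonatomic N" "A \<in> sets N" "0 < measure N A" "0 < e"
  shows "\<exists>B\<in>sets N. B \<subseteq> A \<and> 0 < measure N B \<and> measure N B \<le> e"
proof -
  have *: "\<exists>B\<in>sets N. B \<subseteq> A \<and> 0 < measure N B \<and> measure N B \<le> measure N A / 2 ^ n" for n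
  proof (induction n)
    case 0
    show ?case using assms(3,4) by (intro bexI[of _ A]) auto
  next
    case (Suc n)
    then obtain B where B: "B \<in> sets N" "B \<subseteq> A" "0 < measure N B" "measure N B \<le> measure N A / 2 ^ n"
      by blast
    then obtain C where "C \<in> sets N" "C \<subseteq> B" "0 < measure N C" "measure N C \<le> measure N B / 2"
      using nonatomic_halve[OF assms(1,2)] by blast
    with B show ?case
      by (intro bexI[of _ C]) auto
  qed
  obtain n where "measure N A / e < 2 ^ n"
    using real_arch_pow[of 2 "measure N A / e"] by auto
  then have "measure N A / 2 ^ n < e"
    using assms(5) by (simp add: field_simps)
  moreover obtain B where "B \<in> sets N" "B \<subseteq> A" "0 < measure N B" "measure N B \<le> measure N A / 2 ^ n"
    using *[of n] by blast
  ultimately show ?thesis by (intro bexI[of _ B]) auto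
qed

text \<open>Greedy exhaustion: grow sets inside \<open>A\<close> of measure at most
  \<open>a\<close>, gaining at each step at least half of what any admissible addition could give.
  The gains tend to 0. If the union fell short of \<open>a\<close>, nonatomicity would leave a fixed
  piece that stays admissible forever and keeps the gains away from 0.\<close>

lemma sierpinski_intermediate_value:
  assumes "finite_measure N" "nonatomic N" "A \<in> sets N" "0 \<le> a" "a \<le> measure N A"
  shows "\<exists>B\<in>sets N. B \<subseteq> A \<and> measure N B = a"
proof -
  interpret finite_measure N by fact
  define cand where
    "cand B = {C \<in> sets N. C \<subseteq> A - B \<and> measure N C \<le> a - measure N B}" for B
  define P where "P B \<longleftrightarrow> B \<in> sets N \<and> B \<subseteq> A \<and> measure N B \<le> a" for B
  define Q where "Q B B' \<longleftrightarrow> B \<subseteq> B' \<and>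
    (\<forall>C\<in>cand B. measure N C / 2 \<le> measure N B' - measure N B)" for B B'
  have bdd: "bdd_above (measure N ` X)" for X
    by (rule bdd_aboveI[of _ "measure N (space N)"]) (auto intro: bounded_measure)
  have step: "\<exists>B'. P B' \<and> Q B B'" if "P B" for B
  proof -
    let ?s = "SUP C\<in>cand B. measure N C"
    have ne: "{} \<in> cand B" using that by (auto simp: cand_def P_def)
    have upper: "measure N C \<le> ?s" if "C \<in> cand B" for C
      by (rule cSUP_upper[OF that bdd])
    \<comment> \<open>The supremum itself might not be attained, so half of it is aimed at; when it
      is not positive, the empty set will do.\<close>
    have "\<exists>D\<in>cand B. ?s / 2 \<le> measure N D"
    proof (cases "?s > 0")
      case True
      then have "?s / 2 < ?s" by simp
      then show ?thesis
        using less_cSUP_iff[OF _ bdd, of "cand B" "?s / 2"] ne by (auto intro: less_imp_le)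
    next
      case False
      then show ?thesis using ne by (intro bexI[of _ "{}"]) auto
    qed
    then obtain D where D: "D \<in> cand B" "?s / 2 \<le> measure N D" by blast
    then have "measure N (B \<union> D) = measure N B + measure N D"
      using that by (intro finite_measure_Union) (auto simp: cand_def P_def)
    moreover have "measure N C / 2 \<le> measure N D" if "C \<in> cand B" for C
      using upper[OF that] D(2) by linarith
    ultimately have "P (B \<union> D) \<and> Q B (B \<union> D)"
      using D(1) that unfolding P_def Q_def cand_def by (simp add: sets.Un) blast
    then show ?thesis by blast
  qed
  have "P {}" using assms by (simp add: P_def)
  then obtain S where S: "P (S n)" "Q (S n) (S (Suc n))" for n
    using dependent_nat_choice[of "\<lambda>_. P" "\<lambda>_. Q"] step by metis
  have inc: "incseq S" using S(2) by (auto simp: Q_def intro: incseq_SucI)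
  define B where "B = (\<Union>n. S n)"
  have B: "B \<in> sets N" "B \<subseteq> A" using S(1) by (auto simp: B_def P_def)
  have lim: "(\<lambda>n. measure N (S n)) \<longlonglongrightarrow> measure N B"
    unfolding B_def using S(1) inc by (intro finite_Lim_measure_incseq) (auto simp: P_def)
  then have le: "measure N B \<le> a"
    using S(1) by (intro LIMSEQ_le_const2) (auto simp: P_def)
  have "\<not> measure N B < a"
  proof
    assume lt: "measure N B < a"
    then have "0 < measure N (A - B)"
      using B assms(3,5) by (simp add: finite_measure_Diff)
    then obtain C where C: "C \<in> sets N" "C \<subseteq> A - B" "0 < measure N C" "measure N C \<le> a - measure N B"
      using nonatomic_small_subset[OF assms(1,2), of "A - B" "a - measure N B"] B assms(3) lt
      by auto
    \<comment> \<open>\<open>C\<close> avoids the whole union and fits into the final gap, hence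
      into the larger gap left at every earlier stage.\<close>
    have "C \<in> cand (S n)" for n
    proof -
      have "S n \<subseteq> B" by (auto simp: B_def)
      moreover from this have "measure N (S n) \<le> measure N B"
        using B by (intro finite_measure_mono)
      ultimately show ?thesis using C by (auto simp: cand_def)
    qed
    then have "measure N C / 2 \<le> measure N (S (Suc n)) - measure N (S n)" for n
      using S(2) by (auto simp: Q_def)
    moreover have "(\<lambda>n. measure N (S (Suc n)) - measure N (S n)) \<longlonglongrightarrow> measure N B - measure N B"
      using lim by (intro tendsto_diff LIMSEQ_Suc)
    ultimately have "measure N C / 2 \<le> measure N B - measure N B"
      by (intro LIMSEQ_le_const) auto
    then show False using C by simp
  qed
  then show ?thesis using B le by (intro bexI[of _ B]) auto
qed

section \<open>Fair shares for two measures, and Lipschitz bounds from small steps\<close>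

lemma equal_share_subset:
  assumes "finite_measure lam" "nonatomic lam" "finite_measure \<mu>" "sets \<mu> = sets lam"
    and "A \<in> sets lam"
  shows "\<exists>D\<in>sets lam. D \<subseteq> A \<and> measure lam D = measure lam A / real (Suc n)
           \<and> measure \<mu> D \<le> measure \<mu> A / real (Suc n)"
  using assms(5)
proof (induction n arbitrary: A)
  case 0
  then show ?case by (intro bexI[of _ A]) auto
next
  case (Suc n)
  interpret l: finite_measure lam by fact
  interpret m: finite_measure \<mu> by fact
  let ?q = "real (Suc (Suc n))"
  have "measure lam A / ?q \<le> measure lam A"
    by (simp add: field_simps)
  then obtain B where B: "B \<in> sets lam" "B \<subseteq> A" "measure lam B = measure lam A / ?q"
    using sierpinski_intermediate_value[OF assms(1,2) Suc.prems, of "measure lam A / ?q"] by auto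
  show ?case
  proof (cases "measure \<mu> B \<le> measure \<mu> A / ?q")
    case True
    then show ?thesis using B by blast
  next
    case False
    \<comment> \<open>\<open>B\<close> has more than its share of \<open>\<mu>\<close>, so
      \<open>A - B\<close> has less than the fraction (n+1)/(n+2) of \<open>\<mu>\<close>, and
      exactly that fraction of \<open>lam\<close>. A share 1/(n+1) of \<open>A - B\<close> is
      therefore what is wanted.\<close>
    have "A - B \<in> sets lam" using B Suc.prems by auto
    then obtain D where D: "D \<in> sets lam" "D \<subseteq> A - B"
      "measure lam D = measure lam (A - B) / real (Suc n)"
      "measure \<mu> D \<le> measure \<mu> (A - B) / real (Suc n)"
      using Suc.IH by blast
    have "measure lam (A - B) = measure lam A - measure lam A / ?q"
      using B Suc.prems by (simp add: l.finite_measure_Diff)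
    also have "\<dots> / real (Suc n) = measure lam A / ?q"
      by (simp add: divide_simps) (simp add: algebra_simps)
    finally have 1: "measure lam D = measure lam A / ?q" using D by simp
    have "measure \<mu> (A - B) \<le> measure \<mu> A - measure \<mu> A / ?q"
      using B Suc.prems assms(4) False by (simp add: m.finite_measure_Diff)
    then have "measure \<mu> (A - B) / real (Suc n) \<le> (measure \<mu> A - measure \<mu> A / ?q) / real (Suc n)"
      by (rule divide_right_mono) simp
    also have "\<dots> = measure \<mu> A / ?q"
      by (simp add: divide_simps) (simp add: algebra_simps)
    finally show ?thesis using D 1 by (intro bexI[of _ D]) auto
  qed
qed

text \<open>The hypothesis does not give a bound proportional to the increment, so an interval is
  cut into steps of length at most \<open>l / q\<close>. Rounding their number up costs one extra
  term \<open>m / q\<close>, which vanishes as \<open>q\<close> grows.\<close>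

lemma lipschitz_of_small_steps:
  fixes f :: "real \<Rightarrow> real"
  assumes "0 \<le> m" "0 < l"
    and small: "\<And>n s t. 0 \<le> s \<Longrightarrow> s \<le> t \<Longrightarrow> t \<le> l \<Longrightarrow> t - s \<le> l / real (Suc n) \<Longrightarrow>
      \<bar>f t - f s\<bar> \<le> m / real (Suc n)"
  shows "(m / l)-lipschitz_on {0..l} f"
proof -
  have main: "\<bar>f t - f s\<bar> \<le> m / l * (t - s)" if st: "0 \<le> s" "s \<le> t" "t \<le> l" for s t
  proof -
    have bound: "\<bar>f t - f s\<bar> \<le> m / l * (t - s) + m / real (Suc n)" for n
    proof -
      let ?q = "real (Suc n)"
      \<comment> \<open>Floor plus one keeps \<open>k\<close> positive even when
        \<open>s = t\<close>, makes each step at most \<open>l / q\<close> long, and exceeds the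
        ratio by at most 1.\<close>
      define k where "k = Suc (nat \<lfloor>(t - s) * ?q / l\<rfloor>)"
      have nonneg: "0 \<le> (t - s) * ?q / l" using st assms by simp
      then have k1: "(t - s) * ?q / l \<le> real k" and k2: "real k \<le> (t - s) * ?q / l + 1"
        unfolding k_def by linarith+
      have kpos: "0 < real k" by (simp add: k_def)
      define x where "x i = s + real i * ((t - s) / real k)" for i
      have len: "x (Suc i) - x i = (t - s) / real k" for i
        by (simp add: x_def algebra_simps add_divide_distrib diff_divide_distrib)
      have "(t - s) / real k \<le> l / ?q"
        using k1 kpos assms(2) by (simp add: field_simps)
      moreover have "x i \<le> x (Suc i)" for i
        using len[of i] st(2) by (smt (verit) divide_nonneg_nonneg of_nat_0_le_iff)
      moreover have "0 \<le> x i" for i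
        using st by (simp add: x_def)
      moreover have "x (Suc i) \<le> l" if "i < k" for i
      proof -
        have "real (Suc i) * ((t - s) / real k) \<le> real k * ((t - s) / real k)"
          using that st by (intro mult_right_mono) auto
        then show ?thesis using st kpos by (simp add: x_def)
      qed
      ultimately have each: "\<bar>f (x (Suc i)) - f (x i)\<bar> \<le> m / ?q" if "i < k" for i
        using that len by (intro small) auto
      have "x k = t" "x 0 = s" using kpos by (auto simp: x_def)
      then have "\<bar>f t - f s\<bar> = \<bar>\<Sum>i<k. f (x (Suc i)) - f (x i)\<bar>"
        by (simp add: sum_lessThan_telescope[of "\<lambda>i. f (x i)"])
      also have "\<dots> \<le> (\<Sum>i<k. m / ?q)"
        by (rule order_trans[OF sum_abs sum_mono]) (use each in auto)
      also have "\<dots> = real k * (m / ?q)" by simp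
      also have "\<dots> \<le> ((t - s) * ?q / l + 1) * (m / ?q)"
        using k2 assms(1) by (intro mult_right_mono) auto
      also have "\<dots> = m / l * (t - s) + m / ?q"
        using assms(2) by (simp add: field_simps)
      finally show ?thesis .
    qed
    have "(\<lambda>n. m / l * (t - s) + m / real (Suc n)) \<longlonglongrightarrow> m / l * (t - s) + 0"
      by (intro tendsto_intros LIMSEQ_Suc[OF lim_const_over_n])
    then have "\<bar>f t - f s\<bar> \<le> m / l * (t - s) + 0"
      using bound by (intro LIMSEQ_le_const) auto
    then show ?thesis by simp
  qed
  show ?thesis
  proof (rule lipschitz_onI)
    fix x y assume "x \<in> {0..l}" "y \<in> {0..l}"
    then show "dist (f x) (f y) \<le> m / l * dist x y"
      using main[of x y] main[of y x] by (cases "x \<le> y") (auto simp: dist_real_def abs_minus_commute)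
  qed (use assms in simp)
qed

section \<open>From domination to the Lipschitz condition\<close>

lemma NA_plusD:
  assumes "\<mu> \<in> NA_plus M"
  shows "finite_measure \<mu>" "nonatomic \<mu>" "sets \<mu> = sets M" "space \<mu> = space M"
  using assms sets_eq_imp_space_eq[of \<mu> M] by (auto simp: NA_plus_def)

lemma dominated_imp_lipschitz:
  assumes lam: "lam \<in> NA_plus M" and \<mu>: "\<mu> \<in> NA_plus M"
    and dom: "dominated_by M (\<lambda>S. f (measure lam S)) \<mu>"
  shows "(measure \<mu> (space M) / measure lam (space M))-lipschitz_on {0..measure lam (space M)} f"
proof (cases "measure lam (space M) = 0")
  case True
  \<comment> \<open>The interval is the single point 0, and the quotient is 0 because division by 0
    yields 0.\<close>
  then show ?thesis by (auto intro: lipschitz_onI)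
next
  case False
  interpret l: finite_measure lam using NA_plusD[OF lam] by simp
  interpret m: finite_measure \<mu> using NA_plusD[OF \<mu>] by simp
  note sl = NA_plusD(3)[OF lam] and sm = NA_plusD(3)[OF \<mu>]
  note sierpinski = sierpinski_intermediate_value[OF NA_plusD(1,2)[OF lam], unfolded sl]
  show ?thesis
  proof (rule lipschitz_of_small_steps)
    fix n s t
    assume st: "0 \<le> s" "s \<le> t" "t \<le> measure lam (space M)"
      "t - s \<le> measure lam (space M) / real (Suc n)"
    obtain E where E: "E \<in> sets M" "measure lam E = measure lam (space M) / real (Suc n)"
        "measure \<mu> E \<le> measure \<mu> (space M) / real (Suc n)"
      using equal_share_subset[OF NA_plusD(1,2)[OF lam] NA_plusD(1)[OF \<mu>], of "space M" n]
      by (auto simp: sl sm)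
    obtain D where D: "D \<in> sets M" "D \<subseteq> E" "measure lam D = t - s"
      using sierpinski[of E "t - s"] E st by auto
    have "measure lam (space M - D) = measure lam (space M) - (t - s)"
      using D l.finite_measure_compl[of D] by (simp add: sl NA_plusD(4)[OF lam])
    \<comment> \<open>Outside \<open>D\<close> there is room for measure \<open>s\<close> because
      \<open>t\<close> is at most the total mass. Then \<open>S\<close> and
      \<open>S \<union> D\<close> realise the arguments \<open>s\<close> and \<open>t\<close>, and
      differ only by a subset of the fair share \<open>E\<close>.\<close>
    then obtain S where S: "S \<in> sets M" "S \<subseteq> space M - D" "measure lam S = s"
      using sierpinski[of "space M - D" s] D st by auto
    have lu: "measure lam (S \<union> D) = t"
      using l.finite_measure_Union[of S D] S D by (auto simp: sl)
    have "measure \<mu> (S \<union> D) = measure \<mu> S + measure \<mu> D"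
      using m.finite_measure_Union[of S D] S D by (auto simp: sm)
    moreover have "\<bar>f (measure lam (S \<union> D)) - f (measure lam S)\<bar> \<le> measure \<mu> (S \<union> D) - measure \<mu> S"
      using dom S D unfolding dominated_by_def by auto
    moreover have "measure \<mu> D \<le> measure \<mu> E"
      using D E by (intro m.finite_measure_mono) (auto simp: sm)
    ultimately show "\<bar>f t - f s\<bar> \<le> measure \<mu> (space M) / real (Suc n)"
      using E lu S by simp
  next
    show "0 < measure lam (space M)" using False by (simp add: less_le)
  qed simp
qed

section \<open>From the Lipschitz condition to domination by a multiple of
  \<open>lam\<close>\<close>

lemma scale_in_NA_plus:
  assumes "lam \<in> NA_plus M" "0 \<le> L"
  shows "scale_measure (ennreal L) lam \<in> NA_plus M"
proof -
  interpret finite_measure lam using NA_plusD[OF assms(1)] by simp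
  have fin: "finite_measure (scale_measure (ennreal L) lam)"
    by (rule finite_measureI) (simp add: emeasure_eq_measure ennreal_mult_eq_top_iff)
  have "nonatomic (scale_measure (ennreal L) lam)"
    using NA_plusD(2)[OF assms(1)] assms(2)
    unfolding nonatomic_iff_measure[OF fin] nonatomic_iff_measure[OF finite_measure_axioms]
    \<comment> \<open>For \<open>L = 0\<close> the zero measure is vacuously nonatomic; a positive
      \<open>L\<close> cancels from the strict inequalities.\<close>
    by (cases "L = 0") (simp_all add: zero_less_mult_iff mult_less_cancel_left_pos)
  then show ?thesis using fin NA_plusD(3)[OF assms(1)] by (simp add: NA_plus_def)
qed

lemma lipschitz_imp_dominated:
  assumes lam: "lam \<in> NA_plus M" and lip: "L-lipschitz_on {0..measure lam (space M)} f"
  shows "dominated_by M (\<lambda>S. f (measure lam S)) (scale_measure (ennreal L) lam)"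
  unfolding dominated_by_def
proof (intro ballI impI)
  interpret finite_measure lam using NA_plusD[OF lam] by simp
  fix S T assume ST: "S \<in> sets M" "T \<in> sets M" "S \<subseteq> T"
  have "measure lam S \<le> measure lam T"
    using ST by (intro finite_measure_mono) (auto simp: NA_plusD[OF lam])
  moreover have "measure lam A \<in> {0..measure lam (space M)}" for A
    using bounded_measure[of A] by (simp add: NA_plusD[OF lam])
  ultimately show "\<bar>f (measure lam T) - f (measure lam S)\<bar>
      \<le> measure (scale_measure (ennreal L) lam) T - measure (scale_measure (ennreal L) lam) S"
    \<comment> \<open>Nonnegativity of \<open>L\<close> matters here: \<open>ennreal\<close> would
      turn a negative factor into 0.\<close>
    using lipschitz_onD[OF lip, of "measure lam T" "measure lam S"] lipschitz_on_nonneg[OF lip]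
    by (simp add: dist_real_def right_diff_distrib)
qed

section \<open>Domination, bounded variation and \<open>AC_infty\<close>\<close>

lemma dominated_by_iff_mono:
  "dominated_by M \<nu> \<mu> \<longleftrightarrow>
     mono_on (sets M) (\<lambda>S. measure \<mu> S - \<nu> S) \<and> mono_on (sets M) (\<lambda>S. measure \<mu> S + \<nu> S)"
proof -
  have "\<bar>\<nu> T - \<nu> S\<bar> \<le> measure \<mu> T - measure \<mu> S \<longleftrightarrow>
      measure \<mu> S - \<nu> S \<le> measure \<mu> T - \<nu> T \<and> measure \<mu> S + \<nu> S \<le> measure \<mu> T + \<nu> T" for S T
    by linarith
  then show ?thesis unfolding dominated_by_def monotone_on_def by blast
qed

text \<open>Along a chain the increments of \<open>\<mu>\<close> telescope, so its total mass bounds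
  every variation sum. Membership in \<open>AC_infty\<close> thus reduces to domination
  alone.\<close>

lemma dominated_imp_BV:
  assumes "\<nu> {} = 0" "dominated_by M \<nu> \<mu>"
  shows "\<nu> \<in> BV M"
proof -
  have "(\<Sum>i=1..m. \<bar>\<nu> (S i) - \<nu> (S (i - 1))\<bar>) \<le> measure \<mu> (space M)" if "chain_in M m S" for m S
  proof -
    have "(\<Sum>i=1..m. \<bar>\<nu> (S i) - \<nu> (S (i - 1))\<bar>) = (\<Sum>i<m. \<bar>\<nu> (S (Suc i)) - \<nu> (S i)\<bar>)"
      by (simp add: sum.atLeast1_atMost_eq)
    also have "\<dots> \<le> (\<Sum>i<m. measure \<mu> (S (Suc i)) - measure \<mu> (S i))"
      using that assms(2) by (intro sum_mono) (auto simp: chain_in_def dominated_by_def)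
    also have "\<dots> = measure \<mu> (space M)"
      using that by (simp add: chain_in_def sum_lessThan_telescope[of "\<lambda>i. measure \<mu> (S i)"])
    finally show ?thesis .
  qed
  then show ?thesis using assms(1) by (auto simp: BV_def games_def intro!: bdd_aboveI)
qed

lemma AC_infty_iff_dominated:
  assumes "\<nu> {} = 0"
  shows "\<nu> \<in> AC_infty M \<longleftrightarrow> (\<exists>\<mu>\<in>NA_plus M. dominated_by M \<nu> \<mu>)"
  using dominated_imp_BV[of \<nu> M] assms by (auto simp: AC_infty_def dominated_by_iff_mono)

theorem proposition4p1:
  fixes \<Omega> :: "'a::polish_space set"
    and M lam :: "'a measure"
    and f :: "real \<Rightarrow> real"
    and \<nu> :: "'a set \<Rightarrow> real"
  assumes "\<Omega> \<in> sets borel"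
    and "M = restrict_space borel \<Omega>"
    and "lam \<in> NA_plus M"
    and "f 0 = 0"
    and "\<nu> = (\<lambda>S. f (measure lam S))"
  shows "(\<nu> \<in> AC_infty M \<longleftrightarrow> (\<exists>L. L-lipschitz_on {0..measure lam \<Omega>} f)) \<and>
         ((\<exists>L. L-lipschitz_on {0..measure lam \<Omega>} f) \<longleftrightarrow>
          (\<exists>L. L-lipschitz_on {0..measure lam \<Omega>} f \<and>
               dominated_by M \<nu> (scale_measure (ennreal L) lam))) \<and>
         (\<forall>\<mu>\<in>NA_plus M. dominated_by M \<nu> \<mu> \<longrightarrow>
            (measure \<mu> \<Omega> / measure lam \<Omega>)-lipschitz_on {0..measure lam \<Omega>} f) \<and>
         (measure lam \<Omega> \<ge> 1 \<longrightarrow>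
            (\<forall>\<mu>\<in>NA_plus M. dominated_by M \<nu> \<mu> \<longrightarrow>
               (measure \<mu> \<Omega>)-lipschitz_on {0..measure lam \<Omega>} f)) \<and>
         (\<forall>L. L-lipschitz_on {0..measure lam \<Omega>} f \<longrightarrow>
            dominated_by M \<nu> (scale_measure (ennreal L) lam))"
proof -
  have space: "space M = \<Omega>" using assms(1,2) by (simp add: space_restrict_space)
  have lip: "(measure \<mu> \<Omega> / measure lam \<Omega>)-lipschitz_on {0..measure lam \<Omega>} f"
    if "\<mu> \<in> NA_plus M" "dominated_by M \<nu> \<mu>" for \<mu>
    using dominated_imp_lipschitz[OF assms(3) that(1), of f] that(2) by (simp add: assms(5) space)
  have dom: "dominated_by M \<nu> (scale_measure (ennreal L) lam)"
    if "L-lipschitz_on {0..measure lam \<Omega>} f" for L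
    using lipschitz_imp_dominated[OF assms(3), of L f] that by (simp add: assms(5) space)
  have "\<nu> {} = 0" using assms(4,5) by simp
  then have "\<nu> \<in> AC_infty M \<longleftrightarrow> (\<exists>L. L-lipschitz_on {0..measure lam \<Omega>} f)"
    using lip dom scale_in_NA_plus[OF assms(3) lipschitz_on_nonneg]
    by (metis AC_infty_iff_dominated)
  \<comment> \<open>The quotient is the constant the argument yields; dropping the denominator
    weakens it only if the mass of \<open>lam\<close> is at least 1. For positive mass below 1, the
    identity \<open>f\<close> with \<open>\<mu>\<close> equal to \<open>lam\<close> is a
    counterexample.\<close>
  moreover have "(measure \<mu> \<Omega>)-lipschitz_on {0..measure lam \<Omega>} f"
    if "1 \<le> measure lam \<Omega>" "\<mu> \<in> NA_plus M" "dominated_by M \<nu> \<mu>" for \<mu>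
  proof (rule lipschitz_on_le[OF lip[OF that(2,3)]])
    show "measure \<mu> \<Omega> / measure lam \<Omega> \<le> measure \<mu> \<Omega>"
      using that(1) by (simp add: divide_le_eq mult_le_cancel_left1)
  qed
  ultimately show ?thesis using lip dom by blast
qed

end
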